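(* (Family $(0,0,1/2)$, degenerate Painlevé V.) Let $\theta_0,\theta_1\in\mathbb{C}$, and let $p,q$ be holomorphic functions of $t$ on a connected open set $U\subset\mathbb{C}^*$ with $q$ avoiding $0,1$. Put $$A_0=\begin{pmatrix}-p&\frac{\theta_0^2-4p^2}{4q}\\ q&p\end{pmatrix},\quad A_1=\begin{pmatrix}p&\frac{4p^2-\theta_1^2}{4(q-1)}\\ 1-q&-p\end{pmatrix},\quad A_\infty=\begin{pmatrix}0&t^2\\ 0&0\end{pmatrix},$$ $$B=z\begin{pmatrix}0&2t\\ 0&0\end{pmatrix}+\begin{pmatrix}0&\frac{2p^2}{(q-1)qt}+\frac{\theta_0^2}{2qt}-\frac{\theta_1^2}{2(q-1)t}+2(q-1)t\\ \frac2t&0\end{pmatrix}.$$ Then the operators $\frac{d}{dz}+\frac{A_0}{z}+\frac{A_1}{z-1}+A_\infty$ and $\frac{d}{dt}+B$ commute if and only if $$\frac{dq}{dt}=\frac{4p}{t},\qquad\frac{dp}{dt}=\frac{2(2q-1)p^2}{(q-1)qt}+\frac{(q-1)\theta_0^2}{2qt}-\frac{q\theta_1^2}{2(q-1)t}+2q(q-1)t .$$ This system is the Hamiltonian system $\frac{dq}{dt}=-q(q-1)\frac{\partial H}{\partial p}$, $\frac{dp}{dt}=q(q-1)\frac{\partial H}{\partial q}$ with $$H=-\frac{2p^2}{(q-1)qt}-\frac{\theta_0^2}{2qt}+\frac{\theta_1^2}{2(q-1)t}+2qt,$$ and, with $p=\frac t4q'$, it is equivalent to $$q''=\frac{(2q-1)(q')^2}{2(q-1)q}-\frac{q'}{t}+\frac{2(q-1)\theta_0^2}{qt^2}-\frac{2q\theta_1^2}{(q-1)t^2}+8(q-1)q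 .$$
   Context: Operators act on vector-valued functions of $(z,t)$; $\frac{d}{dz},\frac{d}{dt}$ are the partial derivatives. Two operators $\frac{d}{dz}+A$ and $\frac{d}{dt}+B$ with matrix functions $A(z,t),B(z,t)$ commute iff $\frac{\partial A}{\partial t}=\frac{\partial B}{\partial z}+AB-BA$ identically in $z,t$. In the Hamiltonian equations $H=H(p,q,t)$ with partial derivatives in the independent variables $p,q,t$; $'$ denotes $\frac{d}{dt}$. (This commutation is the isomonodromy condition for the family of connections.) *)

theory Defs
  imports "HOL-Complex_Analysis.Complex_Analysis"
begin

section \<open>Differential operators in two complex variables\<close>

text \<open>
  Complex differentiability of a function of two complex variables: a Frechet derivative that is
  complex linear, with a and b the partial derivatives in z and t. On open sets this is
  holomorphy in (z, t).
\<close>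

definition holomorphic2_on :: "(complex \<Rightarrow> complex \<Rightarrow> complex) \<Rightarrow> (complex \<times> complex) set \<Rightarrow> bool"
  where "holomorphic2_on f D \<longleftrightarrow>
    (\<forall>x\<in>D. \<exists>a b. ((\<lambda>(z, t). f z t) has_derivative (\<lambda>(h, k). a * h + b * k)) (at x within D))"

definition vec_holomorphic2_on ::
    "(complex \<Rightarrow> complex \<Rightarrow> complex^'n) \<Rightarrow> (complex \<times> complex) set \<Rightarrow> bool"
  where "vec_holomorphic2_on Y D \<longleftrightarrow> (\<forall>i. holomorphic2_on (\<lambda>z t. Y z t $ i) D)"

definition dz_op ::
    "(complex \<Rightarrow> complex \<Rightarrow> complex^'n^'n) \<Rightarrow>
     (complex \<Rightarrow> complex \<Rightarrow> complex^'n) \<Rightarrow> complex \<Rightarrow> complex \<Rightarrow> complex^'n"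
  where "dz_op A Y = (\<lambda>z t. (\<chi> i. deriv (\<lambda>w. Y w t $ i) z) + A z t *v Y z t)"

definition dt_op ::
    "(complex \<Rightarrow> complex \<Rightarrow> complex^'n^'n) \<Rightarrow>
     (complex \<Rightarrow> complex \<Rightarrow> complex^'n) \<Rightarrow> complex \<Rightarrow> complex \<Rightarrow> complex^'n"
  where "dt_op B Y = (\<lambda>z t. (\<chi> i. deriv (\<lambda>s. Y z s $ i) t) + B z t *v Y z t)"

definition commute_on ::
    "(complex \<times> complex) set \<Rightarrow>
     ((complex \<Rightarrow> complex \<Rightarrow> complex^'n) \<Rightarrow> complex \<Rightarrow> complex \<Rightarrow> complex^'n) \<Rightarrow>
     ((complex \<Rightarrow> complex \<Rightarrow> complex^'n) \<Rightarrow> complex \<Rightarrow> complex \<Rightarrow> complex^'n) \<Rightarrow> bool"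
  where "commute_on D L M \<longleftrightarrow>
    (\<forall>Y. vec_holomorphic2_on Y D \<longrightarrow> (\<forall>(z, t)\<in>D. L (M Y) z t = M (L Y) z t))"

section \<open>The family of connections\<close>

definition mat2 :: "'a::zero \<Rightarrow> 'a \<Rightarrow> 'a \<Rightarrow> 'a \<Rightarrow> 'a^2^2"
  where "mat2 a b c d = vector [vector [a, b], vector [c, d]]"

definition A0_mat :: "complex \<Rightarrow> complex \<Rightarrow> complex \<Rightarrow> complex^2^2"
  where "A0_mat \<theta>0 p q = mat2 (- p) ((\<theta>0^2 - 4 * p^2) / (4 * q)) q p"

definition A1_mat :: "complex \<Rightarrow> complex \<Rightarrow> complex \<Rightarrow> complex^2^2"
  where "A1_mat \<theta>1 p q = mat2 p ((4 * p^2 - \<theta>1^2) / (4 * (q - 1))) (1 - q) (- p)"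

definition Ainf_mat :: "complex \<Rightarrow> complex^2^2"
  where "Ainf_mat t = mat2 0 (t^2) 0 0"

definition A_conn :: "complex \<Rightarrow> complex \<Rightarrow> (complex \<Rightarrow> complex) \<Rightarrow> (complex \<Rightarrow> complex) \<Rightarrow>
    complex \<Rightarrow> complex \<Rightarrow> complex^2^2"
  where "A_conn \<theta>0 \<theta>1 p q z t =
    map_matrix (\<lambda>a. a / z) (A0_mat \<theta>0 (p t) (q t))
    + map_matrix (\<lambda>a. a / (z - 1)) (A1_mat \<theta>1 (p t) (q t))
    + Ainf_mat t"

definition B0_mat :: "complex \<Rightarrow> complex \<Rightarrow> complex \<Rightarrow> complex \<Rightarrow> complex \<Rightarrow> complex^2^2"
  where "B0_mat \<theta>0 \<theta>1 p q t =
    mat2 0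
         (2 * p^2 / ((q - 1) * q * t) + \<theta>0^2 / (2 * q * t) - \<theta>1^2 / (2 * (q - 1) * t)
            + 2 * (q - 1) * t)
         (2 / t)
         0"

definition B_conn :: "complex \<Rightarrow> complex \<Rightarrow> (complex \<Rightarrow> complex) \<Rightarrow> (complex \<Rightarrow> complex) \<Rightarrow>
    complex \<Rightarrow> complex \<Rightarrow> complex^2^2"
  where "B_conn \<theta>0 \<theta>1 p q z t =
    map_matrix (\<lambda>b. z * b) (mat2 0 (2 * t) 0 0) + B0_mat \<theta>0 \<theta>1 (p t) (q t) t"

section \<open>The nonlinear equations\<close>

definition rhs_q :: "complex \<Rightarrow> complex \<Rightarrow> complex \<Rightarrow> complex"
  where "rhs_q p q t = 4 * p / t"

definition rhs_p :: "complex \<Rightarrow> complex \<Rightarrow> complex \<Rightarrow> complex \<Rightarrow> complex \<Rightarrow> complex"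
  where "rhs_p \<theta>0 \<theta>1 p q t =
    2 * (2 * q - 1) * p^2 / ((q - 1) * q * t) + (q - 1) * \<theta>0^2 / (2 * q * t)
    - q * \<theta>1^2 / (2 * (q - 1) * t) + 2 * q * (q - 1) * t"

definition pq_system :: "complex \<Rightarrow> complex \<Rightarrow> complex set \<Rightarrow>
    (complex \<Rightarrow> complex) \<Rightarrow> (complex \<Rightarrow> complex) \<Rightarrow> bool"
  where "pq_system \<theta>0 \<theta>1 U p q \<longleftrightarrow>
    (\<forall>t\<in>U. deriv q t = rhs_q (p t) (q t) t \<and> deriv p t = rhs_p \<theta>0 \<theta>1 (p t) (q t) t)"

definition Ham :: "complex \<Rightarrow> complex \<Rightarrow> complex \<Rightarrow> complex \<Rightarrow> complex \<Rightarrow> complex"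
  where "Ham \<theta>0 \<theta>1 p q t =
    - (2 * p^2 / ((q - 1) * q * t)) - \<theta>0^2 / (2 * q * t) + \<theta>1^2 / (2 * (q - 1) * t) + 2 * q * t"

text \<open>
  The vector field of a function H(p, q, t) with respect to the non-canonical bracket weighted
  by q(q-1); the partial derivatives are taken in the independent variables p and q.
\<close>

definition ham_q :: "(complex \<Rightarrow> complex \<Rightarrow> complex \<Rightarrow> complex) \<Rightarrow>
    complex \<Rightarrow> complex \<Rightarrow> complex \<Rightarrow> complex"
  where "ham_q H p q t = - q * (q - 1) * deriv (\<lambda>x. H x q t) p"

definition ham_p :: "(complex \<Rightarrow> complex \<Rightarrow> complex \<Rightarrow> complex) \<Rightarrow>
    complex \<Rightarrow> complex \<Rightarrow> complex \<Rightarrow> complex"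
  where "ham_p H p q t = q * (q - 1) * deriv (\<lambda>y. H p y t) q"

definition hamiltonian_system :: "(complex \<Rightarrow> complex \<Rightarrow> complex \<Rightarrow> complex) \<Rightarrow> complex set \<Rightarrow>
    (complex \<Rightarrow> complex) \<Rightarrow> (complex \<Rightarrow> complex) \<Rightarrow> bool"
  where "hamiltonian_system H U p q \<longleftrightarrow>
    (\<forall>t\<in>U. deriv q t = ham_q H (p t) (q t) t \<and> deriv p t = ham_p H (p t) (q t) t)"

definition q_equation :: "complex \<Rightarrow> complex \<Rightarrow> complex set \<Rightarrow> (complex \<Rightarrow> complex) \<Rightarrow> bool"
  where "q_equation \<theta>0 \<theta>1 U q \<longleftrightarrow>
    (\<forall>t\<in>U. (deriv ^^ 2) q t =
      (2 * q t - 1) * (deriv q t)^2 / (2 * (q t - 1) * q t) - deriv q t / t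
      + 2 * (q t - 1) * \<theta>0^2 / (q t * t^2) - 2 * q t * \<theta>1^2 / ((q t - 1) * t^2)
      + 8 * (q t - 1) * q t)"

end

theory Submission
  imports Defs
begin

text \<open>Compose the two operators in both orders, apply them to \<open>Y\<close> and subtract.
  The product rule removes every derivative of \<open>Y\<close>: first-order terms occur in both
  compositions, and second-order terms cancel because mixed partials agree
  (\<open>holomorphic2_on_mixed_partials\<close>). What remains is multiplication by the matrix
  \<open>Bz - At + A ** B - B ** A\<close>. Constant fields detect whether it vanishes, so commuting
  is the zero-curvature equation (\<open>commute_on_dz_op_dt_op_iff\<close>).

  For the explicit matrices this is an identity of rational functions of z with at most simple poles
  at 0 and 1. Entry (2,1) is the equation for q'. The residues of entry (1,1) at the two poles give
  two expressions for p', both equal to \<open>rhs_p\<close>; entry (1,2) is then a consequence, and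
  entry (2,2) is the negative of (1,1) (\<open>zero_curvature_imp_system\<close>,
  \<open>system_imp_zero_curvature\<close>). The Hamiltonian form follows by differentiating H in
  independent variables (\<open>rhs_eq_hamiltonian\<close>), and the scalar equation by solving the
  first equation for p (\<open>pq_system_iff_q_equation\<close>).\<close>

section \<open>Holomorphic functions of two variables and interchange of partial derivatives\<close>

lemma holomorphic2_on_partial_z:
  assumes "holomorphic2_on f D" "open D" "(z, t) \<in> D"
  shows "(\<lambda>w. f w t) field_differentiable at z"
proof -
  obtain a b where "((\<lambda>(z, t). f z t) has_derivative (\<lambda>(h, k). a * h + b * k)) (at (z, t))"
    using assms at_within_open unfolding holomorphic2_on_def by metis
  moreover have "((\<lambda>w. (w, t)) has_derivative (\<lambda>h. (h, 0))) (at z)"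
    by (auto intro!: derivative_eq_intros)
  ultimately have "((\<lambda>w. f w t) has_derivative (\<lambda>h. a * h)) (at z)"
    by (force dest: has_derivative_compose)
  then show ?thesis
    unfolding field_differentiable_def has_field_derivative_def by blast
qed

lemma holomorphic2_on_partial_t:
  assumes "holomorphic2_on f D" "open D" "(z, t) \<in> D"
  shows "f z field_differentiable at t"
proof -
  obtain a b where "((\<lambda>(z, t). f z t) has_derivative (\<lambda>(h, k). a * h + b * k)) (at (z, t))"
    using assms at_within_open unfolding holomorphic2_on_def by metis
  moreover have "((\<lambda>s. (z, s)) has_derivative (\<lambda>k. (0, k))) (at t)"
    by (auto intro!: derivative_eq_intros)
  ultimately have "(f z has_derivative (\<lambda>k. b * k)) (at t)"
    by (force dest: has_derivative_compose)
  then show ?thesis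
    unfolding field_differentiable_def has_field_derivative_def by blast
qed

lemma holomorphic2_on_imp_continuous_on:
  assumes "holomorphic2_on f D"
  shows "continuous_on D (\<lambda>(z, t). f z t)"
  unfolding continuous_on_eq_continuous_within
  using assms has_derivative_continuous unfolding holomorphic2_on_def by blast

text \<open>Cauchy's inequality bounds the second derivative near \<open>t\<close>, and Taylor's
  formula turns this into a rate of convergence. The rate depends on \<open>g\<close> only through
  \<open>K\<close> and \<open>r\<close>, so it is uniform over a family of functions with a common
  bound.\<close>

lemma difference_quotient_bound:
  assumes hol: "g holomorphic_on ball t (3 * r)" and "0 < r"
    and bd: "\<And>u. u \<in> cball t (2 * r) \<Longrightarrow> norm (g u) \<le> K"
    and s: "s \<in> cball t r" "s \<noteq> t"
  shows "norm ((g s - g t) / (s - t) - deriv g t) \<le> 2 * K / r\<^sup>2 * norm (s - t)"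
proof -
  have second: "norm ((deriv ^^ 2) g u) \<le> 2 * K / r\<^sup>2" if u: "u \<in> cball t r" for u
  proof -
    \<comment> \<open>The Cauchy circle around \<open>u\<close> must lie in the disc of radius
      \<open>2 * r\<close>, where the bound \<open>K\<close> holds, and inside the domain of
      holomorphy of radius \<open>3 * r\<close>.\<close>
    have sub: "cball u r \<subseteq> cball t (2 * r)" "cball u r \<subseteq> ball t (3 * r)"
      using u \<open>0 < r\<close> by (auto simp: cball_subset_cball_iff cball_subset_ball_iff dist_commute)
    have h: "g holomorphic_on cball u r"
      using hol sub holomorphic_on_subset by blast
    have "norm ((deriv ^^ 2) g u) \<le> fact 2 * K / r ^ 2"
    proof (rule Cauchy_inequality)
      show "g holomorphic_on ball u r"
        using h holomorphic_on_subset ball_subset_cball by blast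
      show "continuous_on (cball u r) g"
        using h by (rule holomorphic_on_imp_continuous_on)
      show "norm (g x) \<le> K" if "norm (u - x) = r" for x
        using that sub by (intro bd) (auto simp: dist_norm)
    qed fact
    then show ?thesis
      by (simp add: fact_numeral)
  qed
  \<comment> \<open>The remainder estimate of \<open>complex_Taylor\<close> divides by
    \<open>fact 1\<close> rather than \<open>fact 2\<close>, so the factor 2 from Cauchy's
    inequality survives in the final constant.\<close>
  have "norm ((deriv ^^ 0) g s - (\<Sum>i\<le>1. (deriv ^^ i) g t * (s - t) ^ i / fact i))
      \<le> 2 * K / r\<^sup>2 * norm (s - t) ^ Suc 1 / fact 1"
  proof (rule complex_Taylor[of "cball t r" 1 "\<lambda>i. (deriv ^^ i) g"])
    show "((deriv ^^ i) g has_field_derivative (deriv ^^ Suc i) g x) (at x within cball t r)"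
      if "x \<in> cball t r" for i x
      using that \<open>0 < r\<close>
      by (auto intro: has_field_derivative_at_within[OF has_field_derivative_higher_deriv[OF hol]]
          simp del: funpow.simps)
    show "norm ((deriv ^^ Suc 1) g x) \<le> 2 * K / r\<^sup>2" if "x \<in> cball t r" for x
      using second[OF that] by (simp add: numeral_2_eq_2)
  qed (use s \<open>0 < r\<close> in auto)
  then have "norm (g s - g t - deriv g t * (s - t)) \<le> 2 * K / r\<^sup>2 * norm (s - t) * norm (s - t)"
    by (simp add: algebra_simps power2_eq_square)
  moreover have "(g s - g t) / (s - t) - deriv g t = (g s - g t - deriv g t * (s - t)) / (s - t)"
    using s by (simp add: field_simps)
  ultimately show ?thesis
    using s by (simp add: norm_divide pos_divide_le_eq)
qed

text \<open>
  The difference quotients in t converge locally uniformly in z by the Taylor bound, so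
  Weierstrass' theorem lets the derivative in z pass to the limit.
\<close>
lemma holomorphic2_on_mixed_partials:
  assumes hol: "holomorphic2_on f D" and "open D" and zt: "(z, t) \<in> D"
  shows "(\<lambda>w. deriv (f w) t) field_differentiable at z"
    and "((\<lambda>s. deriv (\<lambda>w. f w s) z) has_field_derivative deriv (\<lambda>w. deriv (f w) t) z) (at t)"
proof -
  obtain X Y where XY: "open X" "open Y" "z \<in> X" "t \<in> Y" "X \<times> Y \<subseteq> D"
    using \<open>open D\<close> zt unfolding open_prod_def by fastforce
  obtain d e where d: "d > 0" "cball z d \<subseteq> X" and e: "e > 0" "cball t e \<subseteq> Y"
    using XY unfolding open_contains_cball by metis
  \<comment> \<open>One third leaves room for the three concentric discs of
    \<open>difference_quotient_bound\<close> inside \<open>cball t e\<close>.\<close>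
  define r where "r = e / 3"
  have r: "r > 0" "3 * r = e"
    using e by (auto simp: r_def)
  have sub: "cball z d \<times> cball t (3 * r) \<subseteq> D"
    unfolding r using d(2) e(2) XY(5) by (meson Sigma_mono subset_trans)
  have holt: "f w holomorphic_on ball t (3 * r)" if "w \<in> cball z d" for w
    using that sub
    by (intro holomorphic_onI field_differentiable_at_within[OF
          holomorphic2_on_partial_t[OF hol \<open>open D\<close>]]) auto
  have holz: "(\<lambda>w. f w s) holomorphic_on cball z d" if "s \<in> cball t (3 * r)" for s
    using that sub
    by (intro holomorphic_onI field_differentiable_at_within[OF
          holomorphic2_on_partial_z[OF hol \<open>open D\<close>]]) auto
  have "compact ((\<lambda>(z, t). f z t) ` (cball z d \<times> cball t (3 * r)))"
    using sub continuous_on_subset[OF holomorphic2_on_imp_continuous_on[OF hol]]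
    by (intro compact_continuous_image compact_Times) auto
  then obtain K where K: "\<And>w s. w \<in> cball z d \<Longrightarrow> s \<in> cball t (3 * r) \<Longrightarrow> norm (f w s) \<le> K"
    by (force dest!: compact_imp_bounded simp: bounded_iff)
  define F where "F s w = (f w s - f w t) / (s - t)" for s w
  have bound: "norm (F s w - deriv (f w) t) \<le> 2 * K / r\<^sup>2 * norm (s - t)"
    if "w \<in> cball z d" "s \<in> cball t r" "s \<noteq> t" for s w
    unfolding F_def
    using that r K by (intro difference_quotient_bound holt) auto
  have near: "\<forall>\<^sub>F s in at t. s \<in> cball t r \<and> s \<noteq> t"
    using r eventually_at[of "\<lambda>s. s \<in> cball t r \<and> s \<noteq> t" t UNIV]
    by (auto intro!: exI[of _ r] simp: dist_commute)
  have unif: "uniform_limit (cball z d) F (\<lambda>w. deriv (f w) t) (at t)"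
    unfolding uniform_limit_iff
  proof (intro allI impI)
    fix \<epsilon> :: real assume "\<epsilon> > 0"
    have "((\<lambda>s. 2 * K / r\<^sup>2 * norm (s - t)) \<longlongrightarrow> 2 * K / r\<^sup>2 * norm (t - t)) (at t)"
      by (intro tendsto_intros)
    then have "\<forall>\<^sub>F s in at t. 2 * K / r\<^sup>2 * norm (s - t) < \<epsilon>"
      using \<open>\<epsilon> > 0\<close> by (intro order_tendstoD(2)) auto
    with near show "\<forall>\<^sub>F s in at t. \<forall>w\<in>cball z d. dist (F s w) (deriv (f w) t) < \<epsilon>"
      by eventually_elim (use bound in \<open>force simp: dist_norm\<close>)
  qed
  have holF: "F s holomorphic_on cball z d" if "s \<in> cball t r" "s \<noteq> t" for s
    unfolding F_def using that r by (intro holomorphic_intros holz) auto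
  have evF: "\<forall>\<^sub>F s in at t. continuous_on (cball z d) (F s) \<and> F s holomorphic_on ball z d"
    using near
    by eventually_elim
      (meson holF holomorphic_on_imp_continuous_on holomorphic_on_subset ball_subset_cball)
  have "(\<lambda>w. deriv (f w) t) holomorphic_on ball z d"
    by (rule holomorphic_uniform_limit[OF evF unif]) auto
  then show "(\<lambda>w. deriv (f w) t) field_differentiable at z"
    using d holomorphic_on_imp_differentiable_at by auto
  have "((\<lambda>s. (deriv ^^ 1) (F s) z) \<longlongrightarrow> (deriv ^^ 1) (\<lambda>w. deriv (f w) t) z) (at t)"
  proof (rule higher_deriv_complex_uniform_limit)
    show "uniform_limit (ball z d) F (\<lambda>w. deriv (f w) t) (at t)"
      using unif uniform_limit_on_subset ball_subset_cball by blast
    show "\<forall>\<^sub>F s in at t. F s holomorphic_on ball z d"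
      using evF by eventually_elim auto
  qed (use d in auto)
  then have lim: "((\<lambda>s. deriv (F s) z) \<longlongrightarrow> deriv (\<lambda>w. deriv (f w) t) z) (at t)"
    by simp
  \<comment> \<open>The z-derivative of the difference quotient in t is the difference quotient in t
    of the z-derivative; the limit just found is therefore the other mixed partial.\<close>
  have "deriv (F s) z = (deriv (\<lambda>w. f w s) z - deriv (\<lambda>w. f w t) z) / (s - t)"
    if "s \<in> cball t r" "s \<noteq> t" for s
  proof -
    have "((\<lambda>w. f w u) has_field_derivative deriv (\<lambda>w. f w u) z) (at z)" if "u \<in> cball t r" for u
      unfolding DERIV_deriv_iff_field_differentiable
      using that sub d r by (intro holomorphic2_on_partial_z[OF hol \<open>open D\<close>]) auto
    then show ?thesis
      unfolding F_def using that r by (intro DERIV_imp_deriv DERIV_cdivide DERIV_diff) auto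
  qed
  with near have "\<forall>\<^sub>F s in at t.
      deriv (F s) z = (deriv (\<lambda>w. f w s) z - deriv (\<lambda>w. f w t) z) / (s - t)"
    by (auto elim: eventually_mono)
  then show "((\<lambda>s. deriv (\<lambda>w. f w s) z) has_field_derivative deriv (\<lambda>w. deriv (f w) t) z) (at t)"
    unfolding has_field_derivative_iff using lim by (rule Lim_transform_eventually[rotated])
qed

section \<open>The commutator as a curvature matrix\<close>

text \<open>Both compositions expand by the product rule into \<open>Yzt\<close>,
  \<open>A *v Yt\<close>, \<open>B *v Yz\<close> and terms of order zero in \<open>Y\<close>. The
  first three are common to both, with \<open>Yzt\<close> the same by symmetry of the mixed
  partials, so the commutator contains no derivative of \<open>Y\<close>.\<close>

lemma commutator_dz_op_dt_op:
  fixes A B :: "complex \<Rightarrow> complex \<Rightarrow> complex^'n^'n"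
  assumes Y: "vec_holomorphic2_on Y D" and D: "open D" "(z, t) \<in> D"
    and A: "\<And>i j. ((\<lambda>s. A z s $ i $ j) has_field_derivative At $ i $ j) (at t)"
    and B: "\<And>i j. ((\<lambda>w. B w t $ i $ j) has_field_derivative Bz $ i $ j) (at z)"
  shows "dz_op A (dt_op B Y) z t - dt_op B (dz_op A Y) z t
    = (Bz - At + A z t ** B z t - B z t ** A z t) *v Y z t"
proof -
  have hol: "holomorphic2_on (\<lambda>z t. Y z t $ i) D" for i
    using Y unfolding vec_holomorphic2_on_def by blast
  define Yz where "Yz = (\<chi> i. deriv (\<lambda>w. Y w t $ i) z)"
  define Yt where "Yt = (\<chi> i. deriv (\<lambda>s. Y z s $ i) t)"
  define Yzt where "Yzt = (\<chi> i. deriv (\<lambda>w. deriv (\<lambda>s. Y w s $ i) t) z)"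
  have dY: "((\<lambda>w. Y w t $ i) has_field_derivative Yz $ i) (at z)"
    "((\<lambda>s. Y z s $ i) has_field_derivative Yt $ i) (at t)" for i
    using holomorphic2_on_partial_z[OF hol D] holomorphic2_on_partial_t[OF hol D]
    by (auto simp: Yz_def Yt_def DERIV_deriv_iff_field_differentiable)
  have mixed: "((\<lambda>w. deriv (\<lambda>s. Y w s $ i) t) has_field_derivative Yzt $ i) (at z)"
    "((\<lambda>s. deriv (\<lambda>w. Y w s $ i) z) has_field_derivative Yzt $ i) (at t)" for i
    using holomorphic2_on_mixed_partials[OF hol D]
    by (auto simp: Yzt_def DERIV_deriv_iff_field_differentiable)
  have "deriv (\<lambda>w. dt_op B Y w t $ i) z = (Yzt + Bz *v Y z t + B z t *v Yz) $ i" for i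
    unfolding dt_op_def matrix_vector_mult_def
    by (rule DERIV_imp_deriv)
      (auto intro!: derivative_eq_intros mixed dY B simp: sum.distrib mult.commute algebra_simps)
  then have 1: "dz_op A (dt_op B Y) z t
      = Yzt + Bz *v Y z t + B z t *v Yz + A z t *v (Yt + B z t *v Y z t)"
    by (simp add: dz_op_def vec_eq_iff) (simp add: dt_op_def Yt_def)
  have "deriv (\<lambda>s. dz_op A Y z s $ i) t = (Yzt + At *v Y z t + A z t *v Yt) $ i" for i
    unfolding dz_op_def matrix_vector_mult_def
    by (rule DERIV_imp_deriv)
      (auto intro!: derivative_eq_intros mixed dY A simp: sum.distrib mult.commute algebra_simps)
  then have 2: "dt_op B (dz_op A Y) z t
      = Yzt + At *v Y z t + A z t *v Yt + B z t *v (Yz + A z t *v Y z t)"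
    by (simp add: dt_op_def vec_eq_iff) (simp add: dz_op_def Yz_def)
  show ?thesis
    unfolding 1 2
    by (simp add: matrix_vector_mult_add_rdistrib matrix_vector_mult_diff_rdistrib
        matrix_vector_right_distrib matrix_vector_mul_assoc)
qed

text \<open>A matrix that kills every vector is zero, and each vector is the value of a constant
  field, which is an admissible test function on \<open>D\<close>. Hence commuting forces the
  curvature to vanish at each point.\<close>

lemma commute_on_dz_op_dt_op_iff:
  fixes A B :: "complex \<Rightarrow> complex \<Rightarrow> complex^'n^'n"
  assumes D: "open D"
    and A: "\<And>z t i j. (z, t) \<in> D \<Longrightarrow>
      ((\<lambda>s. A z s $ i $ j) has_field_derivative At z t $ i $ j) (at t)"
    and B: "\<And>z t i j. (z, t) \<in> D \<Longrightarrow>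
      ((\<lambda>w. B w t $ i $ j) has_field_derivative Bz z t $ i $ j) (at z)"
  shows "commute_on D (dz_op A) (dt_op B) \<longleftrightarrow>
    (\<forall>(z, t)\<in>D. At z t = Bz z t + A z t ** B z t - B z t ** A z t)"
proof -
  have const: "vec_holomorphic2_on (\<lambda>z t. v) D" for v :: "complex^'n"
    unfolding vec_holomorphic2_on_def holomorphic2_on_def
    by (auto intro!: exI[of _ 0] simp: case_prod_unfold)
  have comm: "dz_op A (dt_op B Y) z t = dt_op B (dz_op A Y) z t \<longleftrightarrow>
      (Bz z t - At z t + A z t ** B z t - B z t ** A z t) *v Y z t = 0"
    if "vec_holomorphic2_on Y D" "(z, t) \<in> D" for Y z t
    using commutator_dz_op_dt_op[where Y = Y and At = "At z t" and Bz = "Bz z t", OF that(1) D that(2)]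
      A[OF that(2)] B[OF that(2)]
    by (metis eq_iff_diff_eq_0)
  have "commute_on D (dz_op A) (dt_op B) \<longleftrightarrow>
      (\<forall>(z, t)\<in>D. Bz z t - At z t + A z t ** B z t - B z t ** A z t = 0)" (is "_ \<longleftrightarrow> ?R")
  proof
    assume L: "commute_on D (dz_op A) (dt_op B)"
    show ?R
    proof clarify
      fix z t assume zt: "(z, t) \<in> D"
      have "(Bz z t - At z t + A z t ** B z t - B z t ** A z t) *v v = 0 *v v" for v
        using L comm[OF const zt] zt const unfolding commute_on_def by fastforce
      then show "Bz z t - At z t + A z t ** B z t - B z t ** A z t = 0"
        by (subst matrix_eq) blast
    qed
  next
    assume ?R
    then show "commute_on D (dz_op A) (dt_op B)"
      unfolding commute_on_def using comm by fastforce
  qed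
  also have "\<dots> \<longleftrightarrow> (\<forall>(z, t)\<in>D. At z t = Bz z t + A z t ** B z t - B z t ** A z t)"
    by (intro ball_cong refl) (auto simp: algebra_simps)
  finally show ?thesis .
qed

section \<open>The zero-curvature equation for the explicit connection\<close>

lemma mat2_nth [simp]:
  "mat2 a b c d $ 1 $ 1 = a" "mat2 a b c d $ 1 $ 2 = b"
  "mat2 a b c d $ 2 $ 1 = c" "mat2 a b c d $ 2 $ 2 = d"
  by (simp_all add: mat2_def)

lemma mat2_commutator:
  fixes a :: complex
  shows "mat2 a b c (- a) ** mat2 0 \<beta> \<gamma> 0 - mat2 0 \<beta> \<gamma> 0 ** mat2 a b c (- a)
    = mat2 (b * \<gamma> - \<beta> * c) (2 * a * \<beta>) (- 2 * a * \<gamma>) (c * \<beta> - \<gamma> * b)"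
  by (simp add: vec_eq_iff forall_2 matrix_matrix_mult_def sum_2)

lemma A_conn_eq:
  "A_conn \<theta>0 \<theta>1 p q z t =
    mat2 (- p t / z + p t / (z - 1))
      ((\<theta>0\<^sup>2 - 4 * (p t)\<^sup>2) / (4 * q t) / z + (4 * (p t)\<^sup>2 - \<theta>1\<^sup>2) / (4 * (q t - 1)) / (z - 1) + t\<^sup>2)
      (q t / z + (1 - q t) / (z - 1))
      (p t / z + - p t / (z - 1))"
  by (simp add: vec_eq_iff forall_2 A_conn_def A0_mat_def A1_mat_def Ainf_mat_def map_matrix_def)

text \<open>The formal t-derivative of \<open>A_conn\<close>, with the values \<open>dp\<close> and
  \<open>dq\<close> of p' and q' as free arguments, so that zero curvature becomes an algebraic
  relation at each point.\<close>

definition A_conn_dt :: "complex \<Rightarrow> complex \<Rightarrow> complex \<Rightarrow> complex \<Rightarrow> complex \<Rightarrow> complex \<Rightarrow>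
    complex \<Rightarrow> complex \<Rightarrow> complex^2^2"
  where "A_conn_dt \<theta>0 \<theta>1 p q dp dq z t =
    mat2 (- dp / z + dp / (z - 1))
      ((- 8 * p * dp / (4 * q) - (\<theta>0\<^sup>2 - 4 * p\<^sup>2) * dq / (4 * q\<^sup>2)) / z
        + (8 * p * dp / (4 * (q - 1)) - (4 * p\<^sup>2 - \<theta>1\<^sup>2) * dq / (4 * (q - 1)\<^sup>2)) / (z - 1) + 2 * t)
      (dq / z + - dq / (z - 1))
      (dp / z + - dp / (z - 1))"

lemma has_field_derivative_A_conn_t:
  assumes p: "(p has_field_derivative dp) (at t)" and q: "(q has_field_derivative dq) (at t)"
    and nz: "q t \<noteq> 0" "q t \<noteq> 1"
  shows "((\<lambda>s. A_conn \<theta>0 \<theta>1 p q z s $ i $ j) has_field_derivative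
    A_conn_dt \<theta>0 \<theta>1 (p t) (q t) dp dq z t $ i $ j) (at t)"
proof -
  \<comment> \<open>The derivative is left in the unreduced form that the entries of
    \<open>A_conn_dt\<close> have, so that the differentiation rules below match it
    syntactically.\<close>
  have quotient: "((\<lambda>s. n s / (4 * d s)) has_field_derivative
      dn / (4 * d t) - n t * dd / (4 * (d t)\<^sup>2)) (at t)"
    if "(n has_field_derivative dn) (at t)" "(d has_field_derivative dd) (at t)" "d t \<noteq> 0"
    for n d :: "complex \<Rightarrow> complex" and dn dd
    using that by (auto intro!: derivative_eq_intros simp: divide_simps power2_eq_square)
  have "((\<lambda>s. \<theta>0\<^sup>2 - 4 * (p s)\<^sup>2) has_field_derivative - 8 * p t * dp) (at t)"
    "((\<lambda>s. 4 * (p s)\<^sup>2 - \<theta>1\<^sup>2) has_field_derivative 8 * p t * dp) (at t)"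
    "((\<lambda>s. q s - 1) has_field_derivative dq) (at t)"
    by (auto intro!: derivative_eq_intros p q)
  note a = quotient[OF this(1) q] quotient[OF this(2,3)]
  have "q t - 1 \<noteq> 0"
    using nz by simp
  have "((\<lambda>s. 1 - q s) has_field_derivative - dq) (at t)"
    "((\<lambda>s. s\<^sup>2) has_field_derivative 2 * t) (at t)"
    by (auto intro!: derivative_eq_intros q)
  then have "\<forall>i j. ((\<lambda>s. A_conn \<theta>0 \<theta>1 p q z s $ i $ j) has_field_derivative
      A_conn_dt \<theta>0 \<theta>1 (p t) (q t) dp dq z t $ i $ j) (at t)"
    unfolding forall_2 A_conn_eq A_conn_dt_def mat2_nth
    by (intro conjI DERIV_add DERIV_cdivide DERIV_minus p q a nz \<open>q t - 1 \<noteq> 0\<close>)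
  then show ?thesis by blast
qed

lemma has_field_derivative_B_conn_z:
  "((\<lambda>w. B_conn \<theta>0 \<theta>1 p q w t $ i $ j) has_field_derivative mat2 0 (2 * t) 0 0 $ i $ j) (at z)"
  unfolding B_conn_def map_matrix_def
  by (auto intro!: derivative_eq_intros)

text \<open>
  At a single z, the (2,1) and (1,1) entries already give the equations for q' and p'; the value
  z = 2 is one at which both matrices are regular.
\<close>
lemma zero_curvature_imp_system:
  assumes "t \<noteq> 0" "q t \<noteq> 0" "q t \<noteq> 1"
    and eq: "A_conn_dt \<theta>0 \<theta>1 (p t) (q t) dp dq 2 t = mat2 0 (2 * t) 0 0
      + A_conn \<theta>0 \<theta>1 p q 2 t ** B_conn \<theta>0 \<theta>1 p q 2 t
      - B_conn \<theta>0 \<theta>1 p q 2 t ** A_conn \<theta>0 \<theta>1 p q 2 t"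
  shows "dq = rhs_q (p t) (q t) t" "dp = rhs_p \<theta>0 \<theta>1 (p t) (q t) t"
proof -
  note unfold = A_conn_dt_def A_conn_eq B_conn_def B0_mat_def
    map_matrix_def matrix_matrix_mult_def sum_2
  have "q t - 1 \<noteq> 0" using assms by simp
  show "dq = rhs_q (p t) (q t) t"
    using arg_cong[OF eq, of "\<lambda>M :: complex^2^2. M $ 2 $ 1"] assms(1-3)
    by (simp add: unfold rhs_q_def field_simps)
  \<comment> \<open>At z = 2 the left side of entry (1,1) is \<open>- dp / 2 + dp\<close>, whence
    the factor 2; the diagonal of \<open>B_conn\<close> vanishes, so the right side involves only
    off-diagonal entries of \<open>A_conn\<close> and \<open>B_conn\<close>.\<close>
  have dp: "dp = 2 * (((\<theta>0\<^sup>2 - 4 * (p t)\<^sup>2) / (4 * q t) / 2 + (4 * (p t)\<^sup>2 - \<theta>1\<^sup>2) / (4 * (q t - 1)) + t\<^sup>2)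
      * (2 / t) - (4 * t + (2 * (p t)\<^sup>2 / ((q t - 1) * q t * t) + \<theta>0\<^sup>2 / (2 * q t * t)
        - \<theta>1\<^sup>2 / (2 * (q t - 1) * t) + 2 * (q t - 1) * t)) * (q t / 2 + (1 - q t)))"
    using arg_cong[OF eq, of "\<lambda>M :: complex^2^2. M $ 1 $ 1"] by (simp add: unfold)
  show "dp = rhs_p \<theta>0 \<theta>1 (p t) (q t) t"
    unfolding dp rhs_p_def using assms(1-3) \<open>q t - 1 \<noteq> 0\<close> by (simp add: divide_simps) algebra
qed

text \<open>Each entry is compared through its residues at z = 0 and z = 1. Naming the residues
  \<open>a0\<close>, \<open>a1\<close> of the upper right entry of \<open>A_conn\<close>, and the
  z-independent part \<open>b\<close> of the upper right entry of \<open>B_conn\<close>, keeps the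
  rational identities small.\<close>

lemma system_imp_zero_curvature:
  assumes "t \<noteq> 0" "q t \<noteq> 0" "q t \<noteq> 1" "z \<noteq> 0" "z \<noteq> 1"
    and eq: "dq = rhs_q (p t) (q t) t" "dp = rhs_p \<theta>0 \<theta>1 (p t) (q t) t"
  shows "A_conn_dt \<theta>0 \<theta>1 (p t) (q t) dp dq z t = mat2 0 (2 * t) 0 0
      + A_conn \<theta>0 \<theta>1 p q z t ** B_conn \<theta>0 \<theta>1 p q z t
      - B_conn \<theta>0 \<theta>1 p q z t ** A_conn \<theta>0 \<theta>1 p q z t"
proof -
  define P Q y b where "P = p t" and "Q = q t" and "y = z - 1"
    and "b = 2 * P\<^sup>2 / ((Q - 1) * Q * t) + \<theta>0\<^sup>2 / (2 * Q * t) - \<theta>1\<^sup>2 / (2 * (Q - 1) * t)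
            + 2 * (Q - 1) * t"
  define a0 a1 where "a0 = (\<theta>0\<^sup>2 - 4 * P\<^sup>2) / (4 * Q)" and "a1 = (4 * P\<^sup>2 - \<theta>1\<^sup>2) / (4 * (Q - 1))"
  have nz: "t \<noteq> 0" "Q \<noteq> 0" "Q - 1 \<noteq> 0" "z \<noteq> 0" "y \<noteq> 0"
    using assms by (auto simp: Q_def y_def)
  have dq: "dq = 4 * P / t"
    using eq by (simp add: rhs_q_def P_def)
  \<comment> \<open>These are the residues of entry (1,1) at z = 0 and at z = 1; that both equal
    \<open>rhs_p\<close> is the compatibility of the two poles.\<close>
  have dp: "dp = Q * b - 2 * a0 / t" "dp = 2 * a1 / t + (Q - 1) * (b + 2 * t)"
    unfolding eq rhs_p_def a0_def a1_def b_def P_def[symmetric] Q_def[symmetric]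
    using nz by (simp_all add: divide_simps; algebra)+
  \<comment> \<open>The t-derivatives of \<open>a0\<close> and \<open>a1\<close>. Each uses the form
    of \<open>dp\<close> belonging to its own pole, so that the terms from \<open>dq\<close> cancel;
    the results are the residues of entry (1,2) of the commutator.\<close>
  have da0: "- 8 * P * dp / (4 * Q) - (\<theta>0\<^sup>2 - 4 * P\<^sup>2) * dq / (4 * Q\<^sup>2) = - 2 * P * b"
    unfolding dp(1) dq a0_def using nz by (simp add: divide_simps) algebra
  have da1: "8 * P * dp / (4 * (Q - 1)) - (4 * P\<^sup>2 - \<theta>1\<^sup>2) * dq / (4 * (Q - 1)\<^sup>2) = 2 * P * (b + 2 * t)"
    unfolding dp(2) dq a1_def using nz by (simp add: divide_simps) algebra
  have A: "A_conn \<theta>0 \<theta>1 p q z t =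
      mat2 (- P / z + P / y) (a0 / z + a1 / y + t\<^sup>2) (Q / z + (1 - Q) / y) (- (- P / z + P / y))"
    by (simp add: A_conn_eq P_def Q_def a0_def a1_def y_def)
  have B: "B_conn \<theta>0 \<theta>1 p q z t = mat2 0 (z * (2 * t) + b) (2 / t) 0"
    by (simp add: vec_eq_iff forall_2 B_conn_def B0_mat_def map_matrix_def P_def Q_def b_def)
  have At: "A_conn_dt \<theta>0 \<theta>1 (p t) (q t) dp dq z t = mat2 (- dp / z + dp / y)
      (- 2 * P * b / z + 2 * P * (b + 2 * t) / y + 2 * t) (dq / z + - dq / y) (dp / z + - dp / y)"
    unfolding A_conn_dt_def P_def[symmetric] Q_def[symmetric] y_def[symmetric] da0 da1 ..
  have z: "z = y + 1"
    by (simp add: y_def)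
  \<comment> \<open>Substituting a different form of \<open>dp\<close> at each pole leaves an
    identity in which \<open>a0\<close>, \<open>a1\<close> and \<open>b\<close> can be treated as
    independent.\<close>
  have "dp / y - dp / z = (2 * a1 / t + (Q - 1) * (b + 2 * t)) / y - (Q * b - 2 * a0 / t) / z"
    using dp by metis
  also have "\<dots> = (a0 / z + a1 / y + t\<^sup>2) * (2 / t) - (z * (2 * t) + b) * (Q / z + (1 - Q) / y)"
    using nz z by (simp add: divide_simps) (simp add: algebra_simps power2_eq_square)
  finally have e11: "- dp / z + dp / y
      = (a0 / z + a1 / y + t\<^sup>2) * (2 / t) - (z * (2 * t) + b) * (Q / z + (1 - Q) / y)"
    by simp
  have "dp / z + - dp / y = - (- dp / z + dp / y)"
    by simp
  then have e22: "dp / z + - dp / y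
      = (Q / z + (1 - Q) / y) * (z * (2 * t) + b) - (2 / t) * (a0 / z + a1 / y + t\<^sup>2)"
    unfolding e11 by (simp only: minus_diff_eq mult.commute)
  have e12: "- 2 * P * b / z + 2 * P * (b + 2 * t) / y + 2 * t
      = 2 * t + 2 * (- P / z + P / y) * (z * (2 * t) + b)"
    using nz z by (simp add: divide_simps) (simp add: algebra_simps)
  have e21: "dq / z + - dq / y = - 2 * (- P / z + P / y) * (2 / t)"
    unfolding dq using nz by (simp add: divide_simps)
  show ?thesis
    \<comment> \<open>Regrouping the sum brings the two matrix products together as the commutator
      computed in \<open>mat2_commutator\<close>.\<close>
    unfolding At A B add_diff_eq[symmetric] mat2_commutator e11 e12 e21 e22
    by (simp only: vec_eq_iff forall_2 vector_add_component mat2_nth add_0_left)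
qed

lemma commute_on_conn_iff_pq_system:
  assumes "open U" "U \<subseteq> - {0}" "p holomorphic_on U" "q holomorphic_on U"
    and "\<forall>t\<in>U. q t \<noteq> 0 \<and> q t \<noteq> 1"
  shows "commute_on ((- {0, 1}) \<times> U) (dz_op (A_conn \<theta>0 \<theta>1 p q)) (dt_op (B_conn \<theta>0 \<theta>1 p q))
    \<longleftrightarrow> pq_system \<theta>0 \<theta>1 U p q"
proof -
  have "open (- {0, 1 :: complex})"
    by (simp add: open_Compl)
  then have D: "open ((- {0, 1 :: complex}) \<times> U)"
    using assms(1) by (rule open_Times)
  have "commute_on ((- {0, 1}) \<times> U) (dz_op (A_conn \<theta>0 \<theta>1 p q)) (dt_op (B_conn \<theta>0 \<theta>1 p q)) \<longleftrightarrow>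
    (\<forall>(z, t)\<in>(- {0, 1}) \<times> U.
      A_conn_dt \<theta>0 \<theta>1 (p t) (q t) (deriv p t) (deriv q t) z t = mat2 0 (2 * t) 0 0
      + A_conn \<theta>0 \<theta>1 p q z t ** B_conn \<theta>0 \<theta>1 p q z t
      - B_conn \<theta>0 \<theta>1 p q z t ** A_conn \<theta>0 \<theta>1 p q z t)" (is "_ \<longleftrightarrow> ?R")
    using assms
    by (intro commute_on_dz_op_dt_op_iff D has_field_derivative_A_conn_t
        has_field_derivative_B_conn_z) (auto intro: holomorphic_derivI)
  also have "?R \<longleftrightarrow> pq_system \<theta>0 \<theta>1 U p q"
  proof
    assume R: ?R
    show "pq_system \<theta>0 \<theta>1 U p q"
      unfolding pq_system_def
    proof
      fix t assume t: "t \<in> U"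
      then have "t \<noteq> 0" "q t \<noteq> 0" "q t \<noteq> 1"
        using assms by auto
      moreover have "A_conn_dt \<theta>0 \<theta>1 (p t) (q t) (deriv p t) (deriv q t) 2 t = mat2 0 (2 * t) 0 0
          + A_conn \<theta>0 \<theta>1 p q 2 t ** B_conn \<theta>0 \<theta>1 p q 2 t
          - B_conn \<theta>0 \<theta>1 p q 2 t ** A_conn \<theta>0 \<theta>1 p q 2 t"
        using R t by auto
      ultimately show "deriv q t = rhs_q (p t) (q t) t \<and> deriv p t = rhs_p \<theta>0 \<theta>1 (p t) (q t) t"
        using zero_curvature_imp_system by blast
    qed
  next
    assume "pq_system \<theta>0 \<theta>1 U p q"
    then show ?R
      using assms unfolding pq_system_def by (auto intro!: system_imp_zero_curvature)
  qed
  finally show ?thesis .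
qed

section \<open>Hamiltonian form and the scalar second-order equation\<close>

text \<open>Direct differentiation of \<open>Ham\<close>; the bracket weight
  \<open>Q * (Q - 1)\<close> clears the extra factors in the denominators. \<open>P\<close> and
  \<open>Q\<close> are independent numbers here, so the identity concerns the vector fields
  themselves, not only solutions.\<close>

lemma rhs_eq_hamiltonian:
  assumes "t \<noteq> 0" "Q \<noteq> 0" "Q \<noteq> 1"
  shows "rhs_q P Q t = ham_q (Ham \<theta>0 \<theta>1) P Q t"
    and "rhs_p \<theta>0 \<theta>1 P Q t = ham_p (Ham \<theta>0 \<theta>1) P Q t"
proof -
  have nz: "Q - 1 \<noteq> 0"
    using assms by simp
  have "deriv (\<lambda>x. Ham \<theta>0 \<theta>1 x Q t) P = - (4 * P / ((Q - 1) * Q * t))"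
    unfolding Ham_def using assms nz
    by (intro DERIV_imp_deriv) (auto intro!: derivative_eq_intros simp: divide_simps)
  then show "rhs_q P Q t = ham_q (Ham \<theta>0 \<theta>1) P Q t"
    unfolding ham_q_def rhs_q_def using assms nz by simp
  have "deriv (\<lambda>y. Ham \<theta>0 \<theta>1 P y t) Q =
      2 * P\<^sup>2 * (2 * Q - 1) / ((Q - 1)\<^sup>2 * Q\<^sup>2 * t) + \<theta>0\<^sup>2 / (2 * Q\<^sup>2 * t)
      - \<theta>1\<^sup>2 / (2 * (Q - 1)\<^sup>2 * t) + 2 * t"
    unfolding Ham_def using assms nz
    by (intro DERIV_imp_deriv)
      ((rule derivative_eq_intros refl | simp)+, simp add: divide_simps, algebra)
  then show "rhs_p \<theta>0 \<theta>1 P Q t = ham_p (Ham \<theta>0 \<theta>1) P Q t"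
    using assms nz by (simp add: ham_p_def rhs_p_def divide_simps) algebra
qed

text \<open>The first equation can be solved for p because t is nonzero. The relation holds on all
  of the open set \<open>U\<close>, so it may be differentiated, and p' then becomes an expression
  in q' and q''.\<close>

lemma pq_system_iff_q_equation:
  assumes "open U" "U \<subseteq> - {0}" "q holomorphic_on U" "\<forall>t\<in>U. q t \<noteq> 0 \<and> q t \<noteq> 1"
  shows "pq_system \<theta>0 \<theta>1 U p q \<longleftrightarrow>
    (\<forall>t\<in>U. p t = t / 4 * deriv q t) \<and> q_equation \<theta>0 \<theta>1 U q"
proof -
  have first: "deriv q t = rhs_q (p t) (q t) t \<longleftrightarrow> p t = t / 4 * deriv q t" if "t \<in> U" for t
    using that assms(2) by (auto simp: rhs_q_def field_simps)
  have second: "deriv p t = rhs_p \<theta>0 \<theta>1 (p t) (q t) t \<longleftrightarrow> (deriv ^^ 2) q t =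
      (2 * q t - 1) * (deriv q t)^2 / (2 * (q t - 1) * q t) - deriv q t / t
      + 2 * (q t - 1) * \<theta>0^2 / (q t * t^2) - 2 * q t * \<theta>1^2 / ((q t - 1) * t^2)
      + 8 * (q t - 1) * q t" (is "_ \<longleftrightarrow> _ = ?R")
    if p: "\<forall>t\<in>U. p t = t / 4 * deriv q t" and t: "t \<in> U" for t
  proof -
    have nz: "t \<noteq> 0" "q t \<noteq> 0" "q t - 1 \<noteq> 0"
      using assms t by auto
    have "(deriv q has_field_derivative (deriv ^^ 2) q t) (at t)"
      using has_field_derivative_higher_deriv[OF assms(3,1) t, of 1] by (simp add: numeral_2_eq_2)
    then have "((\<lambda>s. s / 4 * deriv q s) has_field_derivative
        deriv q t / 4 + t / 4 * (deriv ^^ 2) q t) (at t)"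
      by (auto intro!: derivative_eq_intros)
    then have "(p has_field_derivative deriv q t / 4 + t / 4 * (deriv ^^ 2) q t) (at t)"
      by (rule has_field_derivative_transform_within_open[OF _ assms(1) t]) (use p in auto)
    then have "deriv p t = deriv q t / 4 + t / 4 * (deriv ^^ 2) q t"
      by (rule DERIV_imp_deriv)
    \<comment> \<open>Inserting p = t q' / 4 gives this value. Against p' = q' / 4 + t q'' / 4, the
      terms q' / 4 cancel and t / 4 can be divided out.\<close>
    moreover have "rhs_p \<theta>0 \<theta>1 (p t) (q t) t = deriv q t / 4 + t / 4 * ?R"
      unfolding rhs_p_def bspec[OF p t] using nz by (simp add: divide_simps) algebra
    ultimately show ?thesis
      using nz by auto
  qed
  show ?thesis
    unfolding pq_system_def q_equation_def using first second by blast
qed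

theorem mainTheorem12:
  fixes \<theta>0 \<theta>1 :: complex and p q :: "complex \<Rightarrow> complex" and U :: "complex set"
  assumes "open U" and "connected U" and "U \<subseteq> - {0}"
    and "p holomorphic_on U" and "q holomorphic_on U"
    and "\<forall>t\<in>U. q t \<noteq> 0 \<and> q t \<noteq> 1"
  shows "(commute_on ((- {0, 1}) \<times> U)
            (dz_op (A_conn \<theta>0 \<theta>1 p q)) (dt_op (B_conn \<theta>0 \<theta>1 p q))
          \<longleftrightarrow> pq_system \<theta>0 \<theta>1 U p q)
    \<and> (\<forall>P Q t. t \<noteq> 0 \<and> Q \<noteq> 0 \<and> Q \<noteq> 1 \<longrightarrow>
          rhs_q P Q t = ham_q (Ham \<theta>0 \<theta>1) P Q t \<and>
          rhs_p \<theta>0 \<theta>1 P Q t = ham_p (Ham \<theta>0 \<theta>1) P Q t)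
    \<and> (pq_system \<theta>0 \<theta>1 U p q \<longleftrightarrow> hamiltonian_system (Ham \<theta>0 \<theta>1) U p q)
    \<and> (pq_system \<theta>0 \<theta>1 U p q \<longleftrightarrow>
          (\<forall>t\<in>U. p t = t / 4 * deriv q t) \<and> q_equation \<theta>0 \<theta>1 U q)"
proof (intro conjI allI impI; (elim conjE)?)
  show "commute_on ((- {0, 1}) \<times> U) (dz_op (A_conn \<theta>0 \<theta>1 p q)) (dt_op (B_conn \<theta>0 \<theta>1 p q))
    \<longleftrightarrow> pq_system \<theta>0 \<theta>1 U p q"
    using assms by (intro commute_on_conn_iff_pq_system)
  show "rhs_q P Q t = ham_q (Ham \<theta>0 \<theta>1) P Q t" "rhs_p \<theta>0 \<theta>1 P Q t = ham_p (Ham \<theta>0 \<theta>1) P Q t"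
    if "t \<noteq> 0" "Q \<noteq> 0" "Q \<noteq> 1" for P Q t
    using that by (rule rhs_eq_hamiltonian)+
  \<comment> \<open>This places the points (p t, q t, t) where the pointwise Hamiltonian identities
    apply.\<close>
  have "t \<noteq> 0 \<and> q t \<noteq> 0 \<and> q t \<noteq> 1" if "t \<in> U" for t
    using that assms by auto
  then show "pq_system \<theta>0 \<theta>1 U p q \<longleftrightarrow> hamiltonian_system (Ham \<theta>0 \<theta>1) U p q"
    unfolding pq_system_def hamiltonian_system_def using rhs_eq_hamiltonian by simp
  show "pq_system \<theta>0 \<theta>1 U p q \<longleftrightarrow>
      (\<forall>t\<in>U. p t = t / 4 * deriv q t) \<and> q_equation \<theta>0 \<theta>1 U q"
    using assms by (intro pq_system_iff_q_equation)
qed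

end
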